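(* Let $F$ be a field, let $P(u)\in F[u]$ with $\deg(P(u)) = N$, and let $A(u),B(u)\in F[u]$ with $0\le \deg(A(u)),\deg(B(u))<N$. Let $M_1(u),\dots,M_n(u)\in F[u]$ be pairwise coprime monic polynomials, $M(u)=\prod_{i=1}^n M_i(u)$, $L=\deg(M(u))$. Let $I_G, I_H\subseteq\{1,\dots,n\}$, $G(u)=\prod_{i\in I_G}M_i(u)$, $H(u)=\prod_{i\in I_H}M_i(u)$ (so $G$ and $H$ divide $M$, $\gcd(G,M/G)=1$ and $\gcd(H,M/H)=1$), $\alpha=\deg(G(u))$, $\beta=\deg(H(u))$, and assume $$2N-2\le\alpha+\beta,\qquad \alpha\le N .$$ Let $\mu(u)=\lfloor G(u)H(u)/P(u)\rfloor$ and assume that each of the polynomials $$X=A\cdot B,\quad D=\lfloor X/G\rfloor,\quad E=D\cdot\mu,\quad Q=\lfloor E/H\rfloor,\quad C=X-Q\cdot P$$ has degree less than $L$. Then the algorithm BA-MPM described in the context, whose inputs are the residues modulo $M_i(u)$ ($i=1,\dots,n$) of $A$, $B$, $P$ and $\mu$, outputs $C_1(u),\dots,C_n(u)$ such that $C_i(u)\equiv C(u) \pmod{M_i(u)}$ for all $i=1,\dots,n$, where $C(u)$ is the remainder of $A(u)\cdot B(u)$ on division by $P(u)$.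
   Context: $\lfloor V(u)/S(u)\rfloor$ denotes the quotient in Euclidean division of $V(u)$ by $S(u)\neq0$ in $F[u]$. A residue modulo $M_i(u)$ means the representative of degree less than $\deg(M_i(u))$ (or zero); the zero polynomial is regarded as having degree less than any nonnegative integer. A subscript $i$ on $A,B,P,\mu$ denotes the residue modulo $M_i(u)$. Two subroutines are used, for a subset $I=\{i_1,\dots,i_a\}\subseteq\{1,\dots,n\}$ of moduli. Quotient computation $\mathrm{Quot}_I$: given residues $Y_i(u)$, $i=1,\dots,n$, set $q_{0,i}=Y_i$ for all $i$; for $k=1,\dots,a$ compute, for every $i\in\{1,\dots,n\}\setminus\{i_1,\dots,i_k\}$, the residue $$q_{k,i}(u)\equiv (q_{k-1,i}(u)-q_{k-1,i_k}(u))\cdot M_{i_k}(u)^{-1}\pmod{M_i(u)};$$ return $q_{a,i}$ for $i\notin I$. Base extension $\mathrm{BEX}_I$: given residues $Y_i(u)$ for $i\notin I$, let $Y(u)$ be the unique polynomial with $\deg(Y)<\sum_{i\notin I}\deg(M_i)$ (or $Y=0$) and $Y\equiv Y_i\pmod{M_i}$ for all $i\notin I$; return the residues of $Y$ modulo $M_i$ for $i\in I$. Algorithm BA-MPM: Step 1: $X_i\equiv A_i\cdot B_i\pmod{M_i}$, $i=1,\dots,n$. Step 2a: apply $\mathrm{Quot}_{I_G}$ to $(X_i)_{i=1}^n$ to get $D_i$ for $i\notin I_G$. Step 2b: apply $\mathrm{BEX}_{I_G}$ to $(D_i)_{i\notin I_G}$ to get $D_i$ for $i\in I_G$. Step 3: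 $E_i\equiv D_i\cdot\mu_i\pmod{M_i}$, $i=1,\dots,n$. Step 4a: apply $\mathrm{Quot}_{I_H}$ to $(E_i)_{i=1}^n$ to get $Q_i$ for $i\notin I_H$. Step 4b: apply $\mathrm{BEX}_{I_H}$ to $(Q_i)_{i\notin I_H}$ to get $Q_i$ for $i\in I_H$. Step 5: output $C_i\equiv X_i-Q_i\cdot P_i\pmod{M_i}$, $i=1,\dots,n$. *)

theory Defs
  imports
    "HOL-Computational_Algebra.Polynomial"
    "HOL-Number_Theory.Cong"
    "HOL-Library.FuncSet"
begin

text \<open>
  The library sets \<^term>\<open>degree 0 = 0\<close>; here the zero polynomial has degree less than every
  natural number, including \<^term>\<open>0\<close>.
\<close>

definition deg_less :: "'a::zero poly \<Rightarrow> nat \<Rightarrow> bool" where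
  "deg_less p d \<longleftrightarrow> p = 0 \<or> degree p < d"

text \<open>
  The reduced representative of the inverse of \<open>p\<close> modulo \<open>m\<close>. For coprime \<open>p\<close> and nonzero \<open>m\<close> it
  exists and is unique, also for constant \<open>m\<close>, where it is \<^term>\<open>0\<close>.
\<close>

definition inv_mod :: "'a::field poly \<Rightarrow> 'a poly \<Rightarrow> 'a poly" where
  "inv_mod p m = (THE z. deg_less z (degree m) \<and> [p * z = 1] (mod m))"

text \<open>
  Families of residues are functions on the index set \<open>{1..n}\<close>, or on a subset of it; outside of the
  indices for which a residue is available the value is \<^const>\<open>undefined\<close>, so that no step can
  rely on a residue that the algorithm does not have.

  The list \<open>js\<close> is the enumeration \<open>i\<^sub>1, \<dots>, i\<^sub>a\<close> of the set of moduli, so that \<open>js ! k\<close> is \<open>i\<^sub>k\<^sub>+\<^sub>1\<close>, and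
  \<open>quot_iter n M js Y k i\<close> is \<open>q\<^sub>k\<^sub>,\<^sub>i\<close>.
\<close>

fun quot_iter ::
  "nat \<Rightarrow> (nat \<Rightarrow> 'a::field poly) \<Rightarrow> nat list \<Rightarrow> (nat \<Rightarrow> 'a poly) \<Rightarrow> nat \<Rightarrow> nat \<Rightarrow> 'a poly"
where
  "quot_iter n M js Y 0 = (\<lambda>i\<in>{1..n}. Y i)"
| "quot_iter n M js Y (Suc k) =
    (\<lambda>i\<in>{1..n} - set (take (Suc k) js).
      ((quot_iter n M js Y k i - quot_iter n M js Y k (js ! k)) * inv_mod (M (js ! k)) (M i)) mod M i)"

definition quot_comp ::
  "nat \<Rightarrow> (nat \<Rightarrow> 'a::field poly) \<Rightarrow> nat list \<Rightarrow> (nat \<Rightarrow> 'a poly) \<Rightarrow> nat \<Rightarrow> 'a poly"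
where
  "quot_comp n M js Y = quot_iter n M js Y (length js)"

definition base_ext ::
  "nat \<Rightarrow> (nat \<Rightarrow> 'a::field poly) \<Rightarrow> nat set \<Rightarrow> (nat \<Rightarrow> 'a poly) \<Rightarrow> nat \<Rightarrow> 'a poly"
where
  "base_ext n M I Y =
    (let Z = (THE Z. deg_less Z (\<Sum>i\<in>{1..n} - I. degree (M i)) \<and>
                     (\<forall>i\<in>{1..n} - I. [Z = Y i] (mod M i)))
     in (\<lambda>i\<in>I. Z mod M i))"

text \<open>
  The arguments \<open>A\<close>, \<open>B\<close>, \<open>P\<close>, \<open>\<mu>\<close> are the families of residues of the input polynomials; \<open>gs\<close> and \<open>hs\<close>
  enumerate the moduli whose products are \<open>G\<close> and \<open>H\<close>.
\<close>

definition ba_mpm ::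
  "nat \<Rightarrow> (nat \<Rightarrow> 'a::field poly) \<Rightarrow> nat list \<Rightarrow> nat list \<Rightarrow>
   (nat \<Rightarrow> 'a poly) \<Rightarrow> (nat \<Rightarrow> 'a poly) \<Rightarrow> (nat \<Rightarrow> 'a poly) \<Rightarrow> (nat \<Rightarrow> 'a poly) \<Rightarrow> nat \<Rightarrow> 'a poly"
where
  "ba_mpm n M gs hs A B P \<mu> =
    (let X  = (\<lambda>i\<in>{1..n}. (A i * B i) mod M i);
         D1 = quot_comp n M gs X;
         D2 = base_ext n M (set gs) D1;
         D  = (\<lambda>i\<in>{1..n}. if i \<in> set gs then D2 i else D1 i);
         E  = (\<lambda>i\<in>{1..n}. (D i * \<mu> i) mod M i);
         Q1 = quot_comp n M hs E;
         Q2 = base_ext n M (set hs) Q1;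
         Q  = (\<lambda>i\<in>{1..n}. if i \<in> set hs then Q2 i else Q1 i)
     in (\<lambda>i\<in>{1..n}. (X i - Q i * P i) mod M i))"

end

theory Submission
  imports Defs
begin

text \<open>
  Two independent facts are combined.

  \<^emph>\<open>The residue computation is exact.\<close> If \<open>Y\<close> is known through its reduced residues modulo all
  moduli, then subtracting \<open>Y mod M\<^sub>j\<close> and multiplying by the inverse of \<open>M\<^sub>j\<close> produces the residues of
  \<open>Y div M\<^sub>j\<close> modulo the other moduli. Since \<open>(Y div p) div q = Y div (p * q)\<close> for polynomials over a
  field, the iteration produces the residues of \<open>Y div G\<close> away from the moduli that make up \<open>G\<close>
  (\<open>quot_iter_eq\<close>). The bound \<open>deg Y < L\<close> gives \<open>deg (Y div G) < L - deg G\<close>, so those remaining residues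
  determine \<open>Y div G\<close> by the Chinese remainder theorem, and the base extension recovers the missing
  ones (\<open>quot_base_ext_eq\<close>). Hence the algorithm computes the residues of \<open>X\<close>, \<open>D\<close>, \<open>E\<close>, \<open>Q\<close> and \<open>C\<close>.

  \<^emph>\<open>Barrett reduction has no correction step over \<open>F[u]\<close>.\<close> Let \<open>r\<close>, \<open>s\<close>, \<open>t\<close> be the remainders of the
  three divisions that define \<open>D\<close>, \<open>\<mu>\<close> and \<open>Q\<close>. Then
  \<open>C * (G * H) = X * s + P * \<mu> * r + P * G * t\<close>, and each summand has degree less than
  \<open>N + deg (G * H)\<close>. So \<open>deg C < N\<close>, and as \<open>C\<close> is congruent to \<open>X\<close> modulo \<open>P\<close> it is the remainder
  (\<open>barrett_reduction\<close>).
\<close>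

section \<open>Coprimality in Euclidean rings\<close>

text \<open>
  A Euclidean ring need not come with a chosen \<open>gcd\<close>. The Euclidean algorithm preserves coprimality
  at every step, which yields Bezout's identity without one; the other facts on coprime elements
  follow from that identity.
\<close>

lemma coprime_iff_bezout:
  fixes a b :: "'a::euclidean_ring"
  shows "coprime a b \<longleftrightarrow> (\<exists>x y. a * x + b * y = 1)"
proof
  show "\<exists>x y. a * x + b * y = 1" if "coprime a b"
    using that
  proof (induction "euclidean_size b" arbitrary: a b rule: less_induct)
    case less
    show ?case
    proof (cases "b = 0")
      case True
      with less.prems have "a dvd 1" by simp
      then show ?thesis using True by (auto elim!: dvdE)
    next
      case False
      then have "coprime b (a mod b)"
        using less.prems by (simp add: coprime_mod_right_iff coprime_commute)
      then obtain x y where "b * x + (a mod b) * y = 1"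
        using less.hyps[of "a mod b" b] mod_size_less[OF False] by blast
      then have "a * y + b * (x - (a div b) * y) = 1"
        by (simp add: minus_div_mult_eq_mod[symmetric] algebra_simps)
      then show ?thesis by blast
    qed
  qed
next
  assume "\<exists>x y. a * x + b * y = 1"
  then show "coprime a b"
    by (metis coprimeI dvd_add dvd_mult2)
qed

lemma coprime_mult_right_euclidean:
  fixes a b c :: "'a::euclidean_ring"
  assumes "coprime a b" "coprime a c"
  shows "coprime a (b * c)"
proof -
  obtain x y z w where 1: "a * x + b * y = 1" and 2: "a * z + c * w = 1"
    using assms by (auto simp: coprime_iff_bezout)
  have "a * (x + b * y * z) + (b * c) * (y * w) = a * x + b * y * (a * z + c * w)"
    by (simp add: algebra_simps)
  then have "a * (x + b * y * z) + (b * c) * (y * w) = 1"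
    by (simp add: 1 2)
  then show ?thesis by (auto simp: coprime_iff_bezout)
qed

lemma coprime_prod_right_euclidean:
  fixes a :: "'a::euclidean_ring"
  assumes "\<And>i. i \<in> S \<Longrightarrow> coprime a (f i)"
  shows "coprime a (\<Prod>i\<in>S. f i)"
  using assms by (induction S rule: infinite_finite_induct) (auto intro: coprime_mult_right_euclidean)

lemma mult_dvd_of_coprime_euclidean:
  fixes a b c :: "'a::euclidean_ring"
  assumes "coprime a b" "a dvd c" "b dvd c"
  shows "a * b dvd c"
proof -
  obtain x y where 1: "a * x + b * y = 1"
    using assms by (auto simp: coprime_iff_bezout)
  have "c = c * (a * x + b * y)" by (simp add: 1)
  also have "\<dots> = (a * c) * x + (c * b) * y"
    by (simp add: algebra_simps)
  also have "a * b dvd \<dots>"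
    using assms by (intro dvd_add dvd_mult2 mult_dvd_mono) auto
  finally show ?thesis .
qed

lemma prod_dvd_of_pairwise_coprime:
  fixes f :: "'b \<Rightarrow> 'a::euclidean_ring"
  assumes "pairwise (\<lambda>i j. coprime (f i) (f j)) S" "\<And>i. i \<in> S \<Longrightarrow> f i dvd c"
  shows "(\<Prod>i\<in>S. f i) dvd c"
  using assms
proof (induction S rule: infinite_finite_induct)
  case (insert j S)
  have "coprime (f j) (\<Prod>i\<in>S. f i)"
    using insert.prems(1) insert.hyps(2)
    by (intro coprime_prod_right_euclidean) (auto simp: pairwise_def)
  moreover have "(\<Prod>i\<in>S. f i) dvd c"
    using insert.prems by (intro insert.IH) (auto simp: pairwise_insert)
  ultimately show ?case
    using insert by (simp add: mult_dvd_of_coprime_euclidean)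
qed auto

section \<open>Degree bounds\<close>

lemma deg_less_add: "deg_less p d \<Longrightarrow> deg_less q d \<Longrightarrow> deg_less (p + q) d"
  unfolding deg_less_def using degree_add_less[of p d q] by (cases "p = 0"; cases "q = 0") simp_all

lemma deg_less_mult:
  fixes p q :: "'a::comm_semiring_0 poly"
  assumes "degree q \<le> e" "deg_less p d" "d + e \<le> k"
  shows "deg_less (q * p) k"
  using assms degree_mult_le[of q p] by (auto simp: deg_less_def)

lemma deg_less_mod:
  fixes m :: "'a::field poly"
  shows "m \<noteq> 0 \<Longrightarrow> deg_less (p mod m) (degree m)"
  using degree_mod_less[of m p] by (auto simp: deg_less_def)

lemma deg_less_iff_mod_eq:
  fixes m :: "'a::field poly"
  assumes "m \<noteq> 0"
  shows "deg_less p (degree m) \<longleftrightarrow> p mod m = p"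
proof
  show "p mod m = p" if "deg_less p (degree m)"
    using that unfolding deg_less_def by (elim disjE) (simp, rule mod_poly_less)
  show "deg_less p (degree m)" if "p mod m = p"
    using deg_less_mod[OF assms, of p] unfolding that .
qed

lemma deg_less_iff_div_eq_0:
  fixes m :: "'a::field poly"
  assumes "m \<noteq> 0"
  shows "deg_less p (degree m) \<longleftrightarrow> p div m = 0"
proof
  show "p div m = 0" if "deg_less p (degree m)"
    using that by (auto simp: deg_less_def div_poly_less)
  show "deg_less p (degree m)" if "p div m = 0"
    using that div_mult_mod_eq[of p m] deg_less_mod[OF assms, of p] by simp
qed

text \<open>
  Reading a degree bound as the vanishing of a quotient turns this estimate into the rule for
  iterated division, and no case distinction on the zero polynomial is needed.
\<close>

lemma deg_less_div:
  fixes g k :: "'a::field poly"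
  assumes "g \<noteq> 0" "k \<noteq> 0" "deg_less p (degree (g * k))"
  shows "deg_less (p div g) (degree k)"
  using assms by (simp add: deg_less_iff_div_eq_0 poly_div_mult_right)

section \<open>Computing a quotient from residues\<close>

lemma cong_inv_mod:
  fixes p m :: "'a::field poly"
  assumes "coprime p m" "m \<noteq> 0"
  shows "[p * inv_mod p m = 1] (mod m)"
proof -
  obtain x y where xy: "p * x + m * y = 1"
    using assms(1) by (auto simp: coprime_iff_bezout)
  have "1 - p * x = m * y"
    using xy by (simp add: algebra_simps)
  then have x: "[p * x = 1] (mod m)"
    by (metis cong_iff_dvd_diff cong_sym dvd_triv_left)
  have "\<exists>!z. deg_less z (degree m) \<and> [p * z = 1] (mod m)"
  proof (rule ex1I[of _ "x mod m"])
    show "deg_less (x mod m) (degree m) \<and> [p * (x mod m) = 1] (mod m)"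
      using x assms(2) by (simp add: deg_less_mod cong_def mod_mult_right_eq)
  next
    fix z assume z: "deg_less z (degree m) \<and> [p * z = 1] (mod m)"
    have "[x * (p * z) = x * 1] (mod m)"
      using z by (intro cong_mult) auto
    moreover have "[(p * x) * z = 1 * z] (mod m)"
      using x by (intro cong_mult) auto
    ultimately have "[z = x] (mod m)"
      by (simp add: cong_def mult_ac)
    then show "z = x mod m"
      using z assms(2) by (simp add: cong_def deg_less_iff_mod_eq)
  qed
  from theI'[OF this] show ?thesis
    by (simp only: inv_mod_def)
qed

text \<open>
  The residue that is subtracted has to be the reduced one: it is then the actual remainder of the
  division by the modulus, and not only congruent to it.
\<close>

lemma quot_iter_eq:
  fixes M :: "nat \<Rightarrow> 'a::field poly"
  assumes nz: "\<And>i. i \<in> {1..n} \<Longrightarrow> M i \<noteq> 0"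
    and cop: "pairwise (\<lambda>i j. coprime (M i) (M j)) {1..n}"
    and js: "distinct js" "set js \<subseteq> {1..n}"
    and Y: "\<And>i. i \<in> {1..n} \<Longrightarrow> Y i = V mod M i"
  shows "k \<le> length js \<Longrightarrow> i \<in> {1..n} - set (take k js) \<Longrightarrow>
    quot_iter n M js Y k i = (V div prod_list (map M (take k js))) mod M i"
proof (induction k arbitrary: i)
  case 0
  then show ?case by (simp add: Y)
next
  case (Suc k)
  define j where "j = js ! k"
  define R where "R = V div prod_list (map M (take k js))"
  have take: "take (Suc k) js = take k js @ [j]"
    using Suc.prems(1) by (simp add: take_Suc_conv_app_nth j_def)
  have i: "i \<in> {1..n}" "i \<noteq> j" "i \<notin> set (take k js)"
    using Suc.prems(2) by (auto simp: take)
  have "distinct (take (Suc k) js)"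
    using js(1) by (rule distinct_take)
  then have j: "j \<notin> set (take k js)"
    by (simp add: take)
  have "j \<in> set js"
    using Suc.prems(1) by (simp add: j_def)
  with js(2) j have j: "j \<in> {1..n}" "j \<notin> set (take k js)"
    by auto
  have qi: "quot_iter n M js Y k i = R mod M i" and qj: "quot_iter n M js Y k j = R mod M j"
    unfolding R_def using Suc.prems(1) i j by (auto intro!: Suc.IH)
  have "coprime (M j) (M i)"
    using cop i j by (auto simp: pairwise_def)
  then have inv: "[M j * inv_mod (M j) (M i) = 1] (mod M i)"
    using nz i by (intro cong_inv_mod) auto
  have "[(R mod M i - R mod M j) * inv_mod (M j) (M i)
         = (R - R mod M j) * inv_mod (M j) (M i)] (mod M i)"
    by (intro cong_mult cong_diff) auto
  also have "(R - R mod M j) * inv_mod (M j) (M i)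
      = (R div M j) * (M j * inv_mod (M j) (M i))"
    by (simp add: minus_mod_eq_div_mult mult_ac)
  also have "[\<dots> = (R div M j) * 1] (mod M i)"
    using inv by (intro cong_mult) auto
  finally have "((R mod M i - R mod M j) * inv_mod (M j) (M i)) mod M i = (R div M j) mod M i"
    by (simp add: cong_def)
  moreover have "V div prod_list (map M (take (Suc k) js)) = R div M j"
    by (simp add: take R_def poly_div_mult_right)
  moreover have "quot_iter n M js Y (Suc k) i =
      ((quot_iter n M js Y k i - quot_iter n M js Y k j) * inv_mod (M j) (M i)) mod M i"
    unfolding j_def quot_iter.simps(2) by (rule restrict_apply') (rule Suc.prems(2))
  ultimately show ?case
    by (simp only: qi qj)
qed

lemma quot_comp_eq:
  fixes M :: "nat \<Rightarrow> 'a::field poly"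
  assumes "\<And>i. i \<in> {1..n} \<Longrightarrow> M i \<noteq> 0"
    and "pairwise (\<lambda>i j. coprime (M i) (M j)) {1..n}"
    and "distinct js" "set js \<subseteq> {1..n}"
    and "\<And>i. i \<in> {1..n} \<Longrightarrow> Y i = V mod M i"
    and "i \<in> {1..n} - set js"
  shows "quot_comp n M js Y i = (V div (\<Prod>i\<in>set js. M i)) mod M i"
proof -
  have "quot_comp n M js Y i = (V div prod_list (map M (take (length js) js))) mod M i"
    unfolding quot_comp_def by (rule quot_iter_eq) (use assms in auto)
  also have "prod_list (map M (take (length js) js)) = (\<Prod>i\<in>set js. M i)"
    using assms(3) by (simp add: prod.distinct_set_conv_list)
  finally show ?thesis .
qed

section \<open>Base extension\<close>

text \<open>
  Two candidates for the polynomial with the given residues differ by a multiple of the product of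
  the moduli, and both are reduced modulo that product. Existence is no issue, because the residues
  are those of a known polynomial within the degree bound.
\<close>

lemma base_ext_eq:
  fixes M :: "nat \<Rightarrow> 'a::field poly"
  assumes nz: "\<And>i. i \<in> {1..n} \<Longrightarrow> M i \<noteq> 0"
    and cop: "pairwise (\<lambda>i j. coprime (M i) (M j)) {1..n}"
    and V: "deg_less V (\<Sum>i\<in>{1..n} - I. degree (M i))"
    and Y: "\<And>i. i \<in> {1..n} - I \<Longrightarrow> [V = Y i] (mod M i)"
    and i: "i \<in> I"
  shows "base_ext n M I Y i = V mod M i"
proof -
  let ?J = "{1..n} - I"
  let ?K = "\<Prod>i\<in>?J. M i"
  have K: "?K \<noteq> 0" using nz by simp
  have degK: "(\<Sum>i\<in>?J. degree (M i)) = degree ?K"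
    using nz by (simp add: degree_prod_eq_sum_degree)
  have "(THE Z. deg_less Z (\<Sum>i\<in>?J. degree (M i)) \<and> (\<forall>i\<in>?J. [Z = Y i] (mod M i))) = V"
  proof (rule the_equality)
    fix Z assume Z: "deg_less Z (\<Sum>i\<in>?J. degree (M i)) \<and> (\<forall>i\<in>?J. [Z = Y i] (mod M i))"
    have "?K dvd Z - V"
    proof (rule prod_dvd_of_pairwise_coprime)
      show "pairwise (\<lambda>i j. coprime (M i) (M j)) ?J"
        using cop by (rule pairwise_subset) auto
      show "M i dvd Z - V" if "i \<in> ?J" for i
        using Z Y[OF that] that by (metis cong_iff_dvd_diff cong_sym cong_trans)
    qed
    then have "Z mod ?K = V mod ?K"
      by (simp add: mod_eq_dvd_iff)
    then show "Z = V"
      using Z V unfolding degK deg_less_iff_mod_eq[OF K] by argo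
  qed (use V Y in auto)
  then show ?thesis
    using i by (simp add: base_ext_def)
qed

lemma quot_base_ext_eq:
  fixes M :: "nat \<Rightarrow> 'a::field poly"
  assumes nz: "\<And>i. i \<in> {1..n} \<Longrightarrow> M i \<noteq> 0"
    and cop: "pairwise (\<lambda>i j. coprime (M i) (M j)) {1..n}"
    and js: "distinct js" "set js \<subseteq> {1..n}"
    and Y: "\<And>i. i \<in> {1..n} \<Longrightarrow> Y i = V mod M i"
    and V: "deg_less V (degree (\<Prod>i\<in>{1..n}. M i))"
    and i: "i \<in> {1..n}"
  shows "(if i \<in> set js then base_ext n M (set js) (quot_comp n M js Y) i else quot_comp n M js Y i)
    = (V div (\<Prod>i\<in>set js. M i)) mod M i"
proof -
  let ?G = "\<Prod>i\<in>set js. M i" and ?K = "\<Prod>i\<in>{1..n} - set js. M i"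
  have G: "?G \<noteq> 0" and K: "?K \<noteq> 0"
    using nz js(2) by auto
  have "(\<Prod>i\<in>{1..n}. M i) = ?G * ?K"
    using js(2) by (subst prod.subset_diff[of "set js"]) (auto simp: mult.commute)
  then have "deg_less (V div ?G) (degree ?K)"
    using V by (intro deg_less_div G K) simp
  then have deg: "deg_less (V div ?G) (\<Sum>i\<in>{1..n} - set js. degree (M i))"
    using nz by (simp add: degree_prod_eq_sum_degree)
  have quot: "quot_comp n M js Y j = (V div ?G) mod M j" if "j \<in> {1..n} - set js" for j
    using quot_comp_eq[OF nz cop js Y that] .
  show ?thesis
    using base_ext_eq[OF nz cop deg, of "quot_comp n M js Y" i] quot i by auto
qed

section \<open>Barrett reduction\<close>

text \<open>
  Clearing the denominators \<open>G\<close> and \<open>H\<close> separates the three rounding errors: \<open>s\<close> is scaled by \<open>X\<close>,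
  which \<open>deg X \<le> deg G + deg H\<close> controls; \<open>r\<close> is scaled by \<open>P * \<mu>\<close>, of degree up to \<open>deg (G * H)\<close>,
  so that \<open>deg r < deg G \<le> deg P\<close> is needed; and \<open>t\<close> is scaled by \<open>P * G\<close>, which fits exactly.
\<close>

lemma barrett_reduction:
  fixes P G H X :: "'a::field poly"
  assumes P: "P \<noteq> 0" and G: "G \<noteq> 0" and H: "H \<noteq> 0"
    and X: "degree X \<le> degree G + degree H"
    and GP: "degree G \<le> degree P"
  shows "X - ((X div G) * ((G * H) div P)) div H * P = X mod P"
proof -
  define \<mu> where "\<mu> = (G * H) div P"
  define D where "D = X div G"
  define Q where "Q = (D * \<mu>) div H"
  define r where "r = X mod G"
  define s where "s = (G * H) mod P"
  define t where "t = (D * \<mu>) mod H"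
  define C where "C = X - Q * P"
  let ?d = "degree P + degree (G * H)"
  have dGH: "degree (G * H) = degree G + degree H"
    using G H by (rule degree_mult_eq)
  have r: "X = D * G + r" and s: "G * H = \<mu> * P + s" and t: "D * \<mu> = Q * H + t"
    by (simp_all add: D_def r_def \<mu>_def s_def Q_def t_def)
  have dr: "deg_less r (degree G)" and ds: "deg_less s (degree P)" and dt: "deg_less t (degree H)"
    using P G H by (simp_all add: r_def s_def t_def deg_less_mod)
  have d\<mu>: "degree (P * \<mu>) \<le> degree (G * H)"
  proof (cases "degree (G * H) < degree P")
    case True
    then show ?thesis by (simp add: \<mu>_def div_poly_less)
  next
    case False
    have "P * \<mu> = G * H - s" by (simp add: s mult.commute)
    then show ?thesis
      using ds False by (auto simp: deg_less_def intro!: degree_diff_le)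
  qed
  have "C * (G * H) = X * (G * H) - (Q * H) * P * G"
    by (simp add: C_def algebra_simps)
  also have "\<dots> = X * (\<mu> * P + s) - (D * \<mu> - t) * P * G"
    using s t by simp
  also have "\<dots> = X * s + P * \<mu> * (X - D * G) + P * G * t"
    by (simp add: algebra_simps)
  also have "\<dots> = X * s + P * \<mu> * r + P * G * t"
    using r by simp
  also have "deg_less \<dots> ?d"
  proof (intro deg_less_add)
    show "deg_less (X * s) ?d"
      using X ds by (rule deg_less_mult) (simp add: dGH)
    show "deg_less (P * \<mu> * r) ?d"
      using d\<mu> dr by (rule deg_less_mult) (simp add: GP)
    show "deg_less (P * G * t) ?d"
      using degree_mult_le dt by (rule deg_less_mult) (simp add: dGH)
  qed
  finally have "C * (G * H) = 0 \<or> degree (C * (G * H)) < ?d"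
    unfolding deg_less_def .
  then have "deg_less C (degree P)"
    using G H degree_mult_eq[of C "G * H"] by (cases "C = 0") (auto simp: deg_less_def)
  moreover have "C mod P = X mod P"
    by (simp add: C_def mod_eq_dvd_iff)
  ultimately show ?thesis
    using P unfolding C_def Q_def D_def \<mu>_def by (simp add: deg_less_iff_mod_eq)
qed

section \<open>Correctness of the algorithm\<close>

theorem mainTheorem2:
  fixes P A B \<mu> G H X D E Q C :: "'a::field poly"
    and M :: "nat \<Rightarrow> 'a poly"
    and n N L \<alpha> \<beta> :: nat
    and IG IH :: "nat set"
    and gs hs :: "nat list"
  assumes "degree P = N"
    and "A \<noteq> 0" and "degree A < N"
    and "B \<noteq> 0" and "degree B < N"
    and "\<forall>i\<in>{1..n}. lead_coeff (M i) = 1"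
    and "pairwise (\<lambda>i j. coprime (M i) (M j)) {1..n}"
    and "L = degree (\<Prod>i\<in>{1..n}. M i)"
    and "IG \<subseteq> {1..n}" and "distinct gs" and "set gs = IG"
    and "IH \<subseteq> {1..n}" and "distinct hs" and "set hs = IH"
    and "G = (\<Prod>i\<in>IG. M i)" and "H = (\<Prod>i\<in>IH. M i)"
    and "\<alpha> = degree G" and "\<beta> = degree H"
    and "2 * N - 2 \<le> \<alpha> + \<beta>" and "\<alpha> \<le> N"
    and "\<mu> = (G * H) div P"
    and "X = A * B" and "deg_less X L"
    and "D = X div G" and "deg_less D L"
    and "E = D * \<mu>" and "deg_less E L"
    and "Q = E div H" and "deg_less Q L"
    and "C = X - Q * P" and "deg_less C L"
  shows "C = (A * B) mod P \<and>
    (\<forall>i\<in>{1..n}.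
      [ba_mpm n M gs hs (\<lambda>i. A mod M i) (\<lambda>i. B mod M i) (\<lambda>i. P mod M i) (\<lambda>i. \<mu> mod M i) i = C]
        (mod M i))"
proof
  have nz: "\<And>i. i \<in> {1..n} \<Longrightarrow> M i \<noteq> 0"
    using assms(6) by force
  have G: "G \<noteq> 0" and H: "H \<noteq> 0"
    using nz assms(9,11,12,14,15,16) by (auto simp: prod_zero_iff finite_subset)
  have P: "P \<noteq> 0" using assms(1,3) by auto
  have "degree X \<le> 2 * N - 2"
    using degree_mult_le[of A B] assms(3,5,22) by simp
  then show "C = (A * B) mod P"
    using barrett_reduction[OF P G H, of X] assms(1,17-30) by simp
  show "\<forall>i\<in>{1..n}.
      [ba_mpm n M gs hs (\<lambda>i. A mod M i) (\<lambda>i. B mod M i) (\<lambda>i. P mod M i) (\<lambda>i. \<mu> mod M i) i = C]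
        (mod M i)"
  proof
    fix i assume i: "i \<in> {1..n}"
    define Xs where "Xs = (\<lambda>i\<in>{1..n}. (A mod M i * (B mod M i)) mod M i)"
    define Ds where "Ds = (\<lambda>i\<in>{1..n}. if i \<in> set gs
      then base_ext n M (set gs) (quot_comp n M gs Xs) i else quot_comp n M gs Xs i)"
    define Es where "Es = (\<lambda>i\<in>{1..n}. (Ds i * (\<mu> mod M i)) mod M i)"
    define Qs where "Qs = (\<lambda>i\<in>{1..n}. if i \<in> set hs
      then base_ext n M (set hs) (quot_comp n M hs Es) i else quot_comp n M hs Es i)"
    have ba: "ba_mpm n M gs hs (\<lambda>i. A mod M i) (\<lambda>i. B mod M i) (\<lambda>i. P mod M i) (\<lambda>i. \<mu> mod M i) i
        = (Xs i - Qs i * (P mod M i)) mod M i"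
      unfolding ba_mpm_def Let_def
      unfolding Xs_def[symmetric] unfolding Ds_def[symmetric]
      unfolding Es_def[symmetric] unfolding Qs_def[symmetric]
      using i by simp
    have Xs: "Xs j = X mod M j" if "j \<in> {1..n}" for j
      using that by (simp add: Xs_def assms(22) mod_mult_eq)
    have Ds: "Ds j = D mod M j" if "j \<in> {1..n}" for j
      using quot_base_ext_eq[OF nz assms(7,10) _ Xs _ that] that assms(8,9,11,15,23,24)
      by (simp add: Ds_def)
    have Es: "Es j = E mod M j" if "j \<in> {1..n}" for j
      using that by (simp add: Es_def Ds assms(26) mod_mult_eq)
    have Qs: "Qs j = Q mod M j" if "j \<in> {1..n}" for j
      using quot_base_ext_eq[OF nz assms(7,13) _ Es _ that] that assms(8,12,14,16,27,28)
      by (simp add: Qs_def)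
    have "[X mod M i - (Q mod M i) * (P mod M i) = X - Q * P] (mod M i)"
      by (intro cong_diff cong_mult) auto
    then show "[ba_mpm n M gs hs (\<lambda>i. A mod M i) (\<lambda>i. B mod M i) (\<lambda>i. P mod M i) (\<lambda>i. \<mu> mod M i) i = C]
        (mod M i)"
      unfolding ba Xs[OF i] Qs[OF i] assms(30) by simp
  qed
qed

end
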